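(* Let $0<q<p$ be real, $n\ge0$ an integer, $a$ a real number, and let $s>0$ be such that the improper $(p,q)$-integral defining $\mathcal L_{p,q}\{t^nE_{p,q}(at)\}(s)$ converges. Then $$\mathcal L_{p,q}\{t^nE_{p,q}(at)\}(s)=\frac{q^{n+1}p^{\binom{n+1}2}[n]_{p,q}!}{\prod_{k=0}^n\left(q^{n+1-k}p^ks-ap^n\right)}.$$
   Context: Let $0<q<p$ be real numbers. For an integer $n\ge 0$, $[n]_{p,q}=\frac{p^n-q^n}{p-q}$, $[n]_{p,q}!=\prod_{k=1}^n[k]_{p,q}$, $[0]_{p,q}!=1$. The $(p,q)$-exponentials are $E_{p,q}(z)=\sum_{n\ge0}\frac{q^{\binom n2}}{[n]_{p,q}!}z^n$ (entire) and $e_{p,q}(z)=\sum_{n\ge0}\frac{p^{\binom n2}}{[n]_{p,q}!}z^n$; the latter series converges for $|z|<p/(p-q)$ and $e_{p,q}$ is extended meromorphically to $\mathbb C$ by $e_{p,q}(z)=1/E_{p,q}(-z)$. The improper $(p,q)$-integral of $f$ is $\int_0^\infty f(x)\,d_{p,q}x=(p-q)\sum_{j=-\infty}^{\infty}\frac{q^j}{p^{j+1}}f\!\left(\frac{q^j}{p^{j+1}}\right)$; it converges if both the sum over $j\ge0$ and the sum over $j<0$ converge. The $(p,q)$-Laplace transform of the second kind is $\mathcal L_{p,q}\{f(t)\}(s)=\int_0^\infty f(t)e_{p,q}(-pts)\,d_{p,q}t$, $s>0$. *)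

theory Defs
  imports Complex_Main
begin

text \<open>Throughout, the parameters are meant to satisfy \<open>0 < q < p\<close>.\<close>

definition pq_number :: "real \<Rightarrow> real \<Rightarrow> nat \<Rightarrow> real"
  where "pq_number p q n = (p ^ n - q ^ n) / (p - q)"

definition pq_fact :: "real \<Rightarrow> real \<Rightarrow> nat \<Rightarrow> real"
  where "pq_fact p q n = (\<Prod>k=1..n. pq_number p q k)"

definition pq_Exp :: "real \<Rightarrow> real \<Rightarrow> 'a \<Rightarrow> 'a::{real_normed_field,banach}"
  where "pq_Exp p q z = (\<Sum>n. (q ^ (n choose 2) / pq_fact p q n) *\<^sub>R z ^ n)"

text \<open>
  The small \<open>(p,q)\<close>-exponential is given by its power series inside the disc of convergence
  and by \<open>1 / pq_Exp p q (-z)\<close> elsewhere (its meromorphic extension). At the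
  poles, all of which are reals \<open>\<ge> p / (p - q)\<close>, the value is the dummy \<open>1 / 0 = 0\<close>.
\<close>

definition pq_exp :: "real \<Rightarrow> real \<Rightarrow> 'a \<Rightarrow> 'a::{real_normed_field,banach}"
  where "pq_exp p q z =
    (if norm z < p / (p - q) then (\<Sum>n. (p ^ (n choose 2) / pq_fact p q n) *\<^sub>R z ^ n)
     else 1 / pq_Exp p q (- z))"

definition pq_node :: "real \<Rightarrow> real \<Rightarrow> int \<Rightarrow> real"
  where "pq_node p q j = q powi j / p powi (j + 1)"

text \<open>
  The bilateral series is split into \<open>j \<ge> 0\<close> and \<open>j < 0\<close>, the latter
  enumerated as \<open>j = -1, -2, \<dots>\<close>; each half is an ordinary (possibly only
  conditionally convergent) series.
\<close>

definition pq_integrable :: "real \<Rightarrow> real \<Rightarrow> (real \<Rightarrow> real) \<Rightarrow> bool"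
  where "pq_integrable p q f \<longleftrightarrow>
    summable (\<lambda>i. pq_node p q (int i) * f (pq_node p q (int i))) \<and>
    summable (\<lambda>i. pq_node p q (- int (Suc i)) * f (pq_node p q (- int (Suc i))))"

definition pq_integral :: "real \<Rightarrow> real \<Rightarrow> (real \<Rightarrow> real) \<Rightarrow> real"
  where "pq_integral p q f = (p - q) *
    ((\<Sum>i. pq_node p q (int i) * f (pq_node p q (int i))) +
     (\<Sum>i. pq_node p q (- int (Suc i)) * f (pq_node p q (- int (Suc i)))))"

definition pq_laplace2_converges :: "real \<Rightarrow> real \<Rightarrow> (real \<Rightarrow> real) \<Rightarrow> real \<Rightarrow> bool"
  where "pq_laplace2_converges p q f s \<longleftrightarrow>
    pq_integrable p q (\<lambda>t. f t * pq_exp p q (- p * t * s))"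

definition pq_laplace2 :: "real \<Rightarrow> real \<Rightarrow> (real \<Rightarrow> real) \<Rightarrow> real \<Rightarrow> real"
  where "pq_laplace2 p q f s = pq_integral p q (\<lambda>t. f t * pq_exp p q (- p * t * s))"

end

theory Submission
  imports Defs
begin

text \<open>
  On the nodes \<open>t\<^sub>j = q\<^sup>j / p\<^sup>j\<^sup>+\<^sup>1\<close> the functional equations of the two exponentials turn the
  integrand factor \<open>g\<^sub>j = E(a t\<^sub>j) e(-p t\<^sub>j s)\<close> into a solution of the first-order recurrence
  \<open>(p + (p - q) a t\<^sub>j) g\<^sub>j\<^sub>+\<^sub>1 = (p + (p - q) p s t\<^sub>j) g\<^sub>j\<close>. Multiplying by a power of \<open>t\<^sub>j\<close> and
  summing over all integers \<open>j\<close> relates consecutive moments of \<open>g\<close>; the zeroth instance telescopes,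
  with \<open>g \<rightarrow> 1\<close> at \<open>+\<infinity>\<close> and \<open>g \<rightarrow> 0\<close> at \<open>-\<infinity>\<close>. The resulting product formula shows that the
  denominator cannot vanish as soon as the integral converges.
\<close>

section \<open>Bilateral series\<close>

text \<open>Two ordered series rather than an unordered sum over the integers, matching
  \<open>pq_integrable\<close>: either half may converge only conditionally.\<close>

definition bisums :: "(int \<Rightarrow> real) \<Rightarrow> real \<Rightarrow> bool"
  where "bisums u S \<longleftrightarrow>
    (\<exists>A B. (\<lambda>i. u (int i)) sums A \<and> (\<lambda>i. u (- int (Suc i))) sums B \<and> S = A + B)"

lemma bisums_cmult: "bisums u S \<Longrightarrow> bisums (\<lambda>j. c * u j) (c * S)"
  unfolding bisums_def by (metis sums_mult distrib_left)

lemma bisums_add: "bisums u S \<Longrightarrow> bisums v T \<Longrightarrow> bisums (\<lambda>j. u j + v j) (S + T)"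
proof -
  assume "bisums u S" "bisums v T"
  then obtain A B C D where
    "(\<lambda>i. u (int i)) sums A" "(\<lambda>i. u (- int (Suc i))) sums B" "S = A + B"
    "(\<lambda>i. v (int i)) sums C" "(\<lambda>i. v (- int (Suc i))) sums D" "T = C + D"
    unfolding bisums_def by blast
  then show ?thesis
    unfolding bisums_def by (intro exI[of _ "A + C"] exI[of _ "B + D"] conjI sums_add) auto
qed

lemma bisums_unique: "bisums u S \<Longrightarrow> bisums u T \<Longrightarrow> S = T"
  unfolding bisums_def by (metis sums_unique2)

text \<open>The shift only moves the term \<open>u 0\<close> from the nonnegative half to the
  negative half, so no rearrangement of either series is involved.\<close>

lemma bisums_shift:
  assumes "bisums u S"
  shows "bisums (\<lambda>j. u (j + 1)) S"
proof -
  obtain A B where AB: "(\<lambda>i. u (int i)) sums A" "(\<lambda>i. u (- int (Suc i))) sums B" "S = A + B"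
    using assms unfolding bisums_def by blast
  have "(\<lambda>i. u (int (Suc i))) sums (A - u 0)"
    using AB(1) sums_Suc_iff[of "\<lambda>i. u (int i)" "A - u 0"] by simp
  then have 1: "(\<lambda>i. u (int i + 1)) sums (A - u 0)"
    by (simp add: add.commute)
  have "(\<lambda>i. u (- int (Suc (Suc i)) + 1)) sums B"
    using AB(2) by simp
  from sums_Suc[OF this] have 2: "(\<lambda>i. u (- int (Suc i) + 1)) sums (B + u 0)"
    by simp
  show ?thesis
    unfolding bisums_def using 1 2 AB(3)
    by (intro exI[of _ "A - u 0"] exI[of _ "B + u 0"]) simp
qed

lemma bisums_telescope:
  assumes "(\<lambda>i. u (int i)) \<longlonglongrightarrow> L" and "(\<lambda>i. u (- int i)) \<longlonglongrightarrow> M"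
  shows "bisums (\<lambda>j. u j - u (j + 1)) (M - L)"
proof -
  have 1: "(\<lambda>i. u (int i) - u (int i + 1)) sums (u 0 - L)"
    using telescope_sums'[OF assms(1)] by (simp add: add.commute)
  have 2: "(\<lambda>i. u (- int (Suc i)) - u (- int (Suc i) + 1)) sums (M - u 0)"
    using telescope_sums[OF assms(2)] by simp
  show ?thesis
    unfolding bisums_def using 1 2
    by (intro exI[of _ "u 0 - L"] exI[of _ "M - u 0"]) simp
qed

lemma summable_geometric_times_Bseq:
  fixes c :: "nat \<Rightarrow> real"
  assumes "Bseq c" and "0 \<le> x" and "x < 1"
  shows "summable (\<lambda>i. x ^ i * c i)"
proof -
  obtain K where K: "\<And>i. norm (c i) \<le> K"
    using assms(1) by (auto simp: Bseq_def)
  have "summable (\<lambda>i. K * x ^ i)"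
    using assms(2,3) by (intro summable_mult summable_geometric) auto
  then show ?thesis
    using K assms(2)
    by (elim summable_comparison_test'[where N = 0])
      (auto simp: abs_mult mult.commute intro: mult_right_mono)
qed

section \<open>The exponentials\<close>

lemma pq_number_Suc_pos: "0 < q \<Longrightarrow> q < p \<Longrightarrow> 0 < pq_number p q (Suc n)"
  unfolding pq_number_def by (intro divide_pos_pos) (auto simp del: power_Suc intro: power_strict_mono)

lemma pq_number_mult: "q < p \<Longrightarrow> pq_number p q n * (p - q) = p ^ n - q ^ n"
  by (simp add: pq_number_def)

lemma pq_fact_0 [simp]: "pq_fact p q 0 = 1"
  by (simp add: pq_fact_def)

lemma pq_fact_Suc: "pq_fact p q (Suc n) = pq_fact p q n * pq_number p q (Suc n)"
  by (simp add: pq_fact_def)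

lemma pq_fact_pos: "0 < q \<Longrightarrow> q < p \<Longrightarrow> 0 < pq_fact p q n"
  by (induction n) (auto simp: pq_fact_Suc pq_number_Suc_pos)

lemma Suc_choose_2: "Suc n choose 2 = n + (n choose 2)"
  by (simp add: numeral_2_eq_2)

lemma zero_choose_2 [simp]: "0 choose 2 = 0"
  by (simp add: numeral_2_eq_2)

text \<open>The factor \<open>1 - (q / p) ^ Suc n\<close> cancels the last factor of
  \<open>pq_fact p q (Suc n)\<close>. Taking \<open>x = q\<close> gives the coefficients of
  \<open>pq_Exp\<close>, and \<open>x = p\<close> those of \<open>pq_exp\<close>.\<close>

lemma exp_coeff_Suc:
  assumes "0 < q" and "q < p"
  shows "x ^ (Suc n choose 2) / pq_fact p q (Suc n) * (1 - (q / p) ^ Suc n) =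
    (1 - q / p) * (x / p) ^ n * (x ^ (n choose 2) / pq_fact p q n)"
proof -
  have pos: "0 < pq_fact p q n" "0 < pq_number p q (Suc n)"
    using assms by (auto intro: pq_fact_pos pq_number_Suc_pos)
  have "1 - (q / p) ^ Suc n = pq_number p q (Suc n) * (p - q) / p ^ Suc n"
    using assms by (simp add: pq_number_mult power_divide diff_divide_distrib del: power_Suc)
  then have "x ^ (Suc n choose 2) / pq_fact p q (Suc n) * (1 - (q / p) ^ Suc n) =
      x ^ n * x ^ (n choose 2) / (pq_fact p q n * pq_number p q (Suc n)) *
      (pq_number p q (Suc n) * (p - q) / p ^ Suc n)"
    by (simp only: pq_fact_Suc Suc_choose_2 power_add)
  also have "\<dots> = (1 - q / p) * (x / p) ^ n * (x ^ (n choose 2) / pq_fact p q n)"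
    using pos assms by (simp add: field_simps)
  finally show ?thesis .
qed

text \<open>Compare coefficients of \<open>z ^ Suc n\<close>: the difference of the two series has
  \<open>c (Suc n) * (1 - r ^ Suc n)\<close> there, which the recurrence lowers to index
  \<open>n\<close>. Used with \<open>r = q / p\<close>, and with \<open>w = q / p\<close> for
  \<open>pq_Exp\<close> but \<open>w = 1\<close> for the series of \<open>pq_exp\<close>.\<close>

lemma powser_dilation:
  fixes c :: "nat \<Rightarrow> real"
  assumes c: "\<And>n. c (Suc n) * (1 - r ^ Suc n) = k * w ^ n * c n"
    and s: "summable (\<lambda>n. c n * z ^ n)" "summable (\<lambda>n. c n * (r * z) ^ n)"
      "summable (\<lambda>n. c n * (w * z) ^ n)"
  shows "(\<Sum>n. c n * z ^ n) - (\<Sum>n. c n * (r * z) ^ n) = k * z * (\<Sum>n. c n * (w * z) ^ n)"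
proof -
  have "(\<lambda>n. c n * z ^ n - c n * (r * z) ^ n) sums
      ((\<Sum>n. c n * z ^ n) - (\<Sum>n. c n * (r * z) ^ n))"
    using s by (intro sums_diff summable_sums)
  then have "(\<lambda>n. c (Suc n) * z ^ Suc n - c (Suc n) * (r * z) ^ Suc n) sums
      ((\<Sum>n. c n * z ^ n) - (\<Sum>n. c n * (r * z) ^ n))"
    by (subst sums_Suc_iff) simp
  moreover have "c (Suc n) * z ^ Suc n - c (Suc n) * (r * z) ^ Suc n =
      k * z * (c n * (w * z) ^ n)" for n
  proof -
    have "c (Suc n) * z ^ Suc n - c (Suc n) * (r * z) ^ Suc n =
        c (Suc n) * (1 - r ^ Suc n) * z ^ Suc n"
      by (simp only: power_mult_distrib) (simp add: algebra_simps)
    also have "\<dots> = k * z * (c n * (w * z) ^ n)"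
      by (subst c) (simp add: power_mult_distrib)
    finally show ?thesis .
  qed
  ultimately have "(\<lambda>n. k * z * (c n * (w * z) ^ n)) sums
      ((\<Sum>n. c n * z ^ n) - (\<Sum>n. c n * (r * z) ^ n))"
    by simp
  moreover have "(\<lambda>n. k * z * (c n * (w * z) ^ n)) sums (k * z * (\<Sum>n. c n * (w * z) ^ n))"
    using s(3) by (intro sums_mult summable_sums)
  ultimately show ?thesis
    using sums_unique2 by blast
qed

lemma tendsto_powser_dilate:
  fixes c :: "nat \<Rightarrow> real"
  assumes "\<And>z. norm z < R \<Longrightarrow> summable (\<lambda>n. c n * z ^ n)" and "0 < R"
    and "\<bar>r\<bar> < 1"
  shows "(\<lambda>i. \<Sum>n. c n * (x * r ^ i) ^ n) \<longlonglongrightarrow> c 0"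
proof -
  have "isCont (\<lambda>z. \<Sum>n. c n * z ^ n) 0"
    using assms(2) by (intro isCont_powser[where K = "R / 2"] assms(1)) auto
  moreover have "(\<lambda>i. x * r ^ i) \<longlonglongrightarrow> 0"
    using assms(3) by (intro tendsto_mult_right_zero LIMSEQ_power_zero) simp
  ultimately have "(\<lambda>i. \<Sum>n. c n * (x * r ^ i) ^ n) \<longlonglongrightarrow> (\<Sum>n. c n * 0 ^ n)"
    by (rule isCont_tendsto_compose)
  then show ?thesis
    by simp
qed

section \<open>Convergence and functional equations of the two exponentials\<close>

context
  fixes p q :: real
  assumes q_pos: "0 < q" and q_less: "q < p"
begin

lemma ratio_bounds: "0 < q / p" "q / p < 1"
  using q_pos q_less by auto

text \<open>Ratio test: by \<open>exp_coeff_Suc\<close> the quotient of consecutive terms is the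
  sequence in \<open>lim\<close> divided by \<open>1 - (q / p) ^ Suc n\<close>, and this divisor
  tends to 1. For \<open>x = q\<close> the limit is 0 at every \<open>z\<close>; for
  \<open>x = p\<close> it is \<open>(1 - q / p) * \<bar>z\<bar>\<close>, which is below 1 exactly on
  the disc of radius \<open>p / (p - q)\<close>.\<close>

lemma summable_exp_coeffs:
  assumes x: "0 < x" and lim: "(\<lambda>n. (1 - q / p) * (x / p) ^ n * \<bar>z\<bar>) \<longlonglongrightarrow> l" and l: "l < 1"
  shows "summable (\<lambda>n. x ^ (n choose 2) / pq_fact p q n * z ^ n)"
proof -
  define c where "c = (\<lambda>n. x ^ (n choose 2) / pq_fact p q n)"
  have cpos: "0 < c n" for n
    using x pq_fact_pos[OF q_pos q_less] by (simp add: c_def)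
  have "(\<lambda>n. (1 - q / p) * (x / p) ^ n * \<bar>z\<bar> / (1 - (q / p) ^ Suc n)) \<longlonglongrightarrow> l / (1 - 0)"
    using ratio_bounds by (intro tendsto_intros lim LIMSEQ_Suc LIMSEQ_power_zero) auto
  moreover obtain d where d: "l < d" "d < 1"
    using l dense by blast
  ultimately have "\<forall>\<^sub>F n in sequentially.
      (1 - q / p) * (x / p) ^ n * \<bar>z\<bar> / (1 - (q / p) ^ Suc n) < d"
    by (auto dest: order_tendstoD)
  then obtain N where N: "\<And>n. n \<ge> N \<Longrightarrow>
      (1 - q / p) * (x / p) ^ n * \<bar>z\<bar> / (1 - (q / p) ^ Suc n) < d"
    by (auto simp: eventually_sequentially)
  have "norm (c (Suc n) * z ^ Suc n) \<le> d * norm (c n * z ^ n)" if "n \<ge> N" for n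
  proof -
    have D: "0 < 1 - (q / p) ^ Suc n"
      using ratio_bounds power_Suc_less_one[of "q / p" n] by simp
    have "c (Suc n) * (1 - (q / p) ^ Suc n) = (1 - q / p) * (x / p) ^ n * c n"
      unfolding c_def by (rule exp_coeff_Suc[OF q_pos q_less])
    then have c_Suc: "c (Suc n) = (1 - q / p) * (x / p) ^ n / (1 - (q / p) ^ Suc n) * c n"
      using D by (metis less_irrefl nonzero_eq_divide_eq times_divide_eq_left)
    have "norm (c (Suc n) * z ^ Suc n) = c (Suc n) * \<bar>z\<bar> ^ Suc n"
      using cpos[of "Suc n"] by (simp add: abs_mult power_abs del: power_Suc)
    also have "\<dots> =
        (1 - q / p) * (x / p) ^ n * \<bar>z\<bar> / (1 - (q / p) ^ Suc n) * norm (c n * z ^ n)"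
      using cpos[of n] by (simp add: c_Suc abs_mult power_abs)
    also have "\<dots> \<le> d * norm (c n * z ^ n)"
      using N[OF that] by (intro mult_right_mono) auto
    finally show ?thesis .
  qed
  then have "summable (\<lambda>n. c n * z ^ n)"
    using d by (intro summable_ratio_test[of d N]) auto
  then show ?thesis
    by (simp add: c_def)
qed

lemma summable_pq_Exp: "summable (\<lambda>n. q ^ (n choose 2) / pq_fact p q n * z ^ n)"
proof (rule summable_exp_coeffs[OF q_pos])
  show "(\<lambda>n. (1 - q / p) * (q / p) ^ n * \<bar>z\<bar>) \<longlonglongrightarrow> (1 - q / p) * 0 * \<bar>z\<bar>"
    using ratio_bounds by (intro tendsto_intros LIMSEQ_power_zero) auto
qed simp

lemma summable_pq_exp:
  assumes "\<bar>z\<bar> < p / (p - q)"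
  shows "summable (\<lambda>n. p ^ (n choose 2) / pq_fact p q n * z ^ n)"
proof (rule summable_exp_coeffs)
  show "(\<lambda>n. (1 - q / p) * (p / p) ^ n * \<bar>z\<bar>) \<longlonglongrightarrow> (1 - q / p) * \<bar>z\<bar>"
    using q_pos q_less by simp
  show "(1 - q / p) * \<bar>z\<bar> < 1"
    using assms q_pos q_less by (simp add: field_simps)
qed (use q_pos q_less in simp)

lemma pq_Exp_dilate: "pq_Exp p q (z :: real) = (1 + (1 - q / p) * z) * pq_Exp p q (q / p * z)"
proof -
  have "pq_Exp p q z - pq_Exp p q (q / p * z) = (1 - q / p) * z * pq_Exp p q (q / p * z)"
    unfolding pq_Exp_def real_scaleR_def
    by (rule powser_dilation[OF exp_coeff_Suc[OF q_pos q_less]]) (rule summable_pq_Exp)+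
  then show ?thesis
    by (simp add: algebra_simps)
qed

lemma pq_Exp_tendsto_1: "(\<lambda>i. pq_Exp p q (x * (q / p) ^ i :: real)) \<longlonglongrightarrow> 1"
  using tendsto_powser_dilate[where c = "\<lambda>n. q ^ (n choose 2) / pq_fact p q n" and R = 1 and r = "q / p"]
    summable_pq_Exp ratio_bounds
  unfolding pq_Exp_def real_scaleR_def by simp

text \<open>All terms are nonnegative and the constant term is 1. This keeps the reciprocals of
  \<open>pq_Exp\<close> below away from the dummy value \<open>1 / 0\<close>.\<close>

lemma pq_Exp_pos:
  assumes "0 \<le> (z :: real)"
  shows "0 < pq_Exp p q z"
proof -
  have "(\<Sum>n<1. q ^ (n choose 2) / pq_fact p q n * z ^ n) \<le> pq_Exp p q z"
    unfolding pq_Exp_def real_scaleR_def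
    using assms q_pos pq_fact_pos[OF q_pos q_less]
    by (intro sum_le_suminf summable_pq_Exp) (auto intro!: mult_nonneg_nonneg divide_nonneg_pos)
  then show ?thesis
    by simp
qed

text \<open>Inside the disc of convergence, \<open>e(-z) E(z)\<close> is invariant under \<open>z \<mapsto> q z / p\<close> and
  continuous at \<open>0\<close>, hence constant.\<close>

lemma pq_exp_minus:
  assumes "0 \<le> (z :: real)"
  shows "pq_exp p q (- z) = 1 / pq_Exp p q z"
proof (cases "z < p / (p - q)")
  case True
  define e where "e = (\<lambda>z. \<Sum>n. p ^ (n choose 2) / pq_fact p q n * z ^ n)"
  have e: "e (- (q / p * y)) = (1 + (1 - q / p) * y) * e (- y)"
    if y: "0 \<le> y" "y < p / (p - q)" for y
  proof -
    have "q / p * y \<le> y"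
      using ratio_bounds y by (intro mult_left_le_one_le) auto
    then have "\<bar>q / p * - y\<bar> < p / (p - q)" "\<bar>1 * - y\<bar> < p / (p - q)" "\<bar>- y\<bar> < p / (p - q)"
      using y q_pos q_less by (auto simp: abs_mult)
    \<comment> \<open>With \<open>x = p\<close> the dilation \<open>x / p\<close> is 1, so the
      right-hand side of the functional equation contains \<open>e\<close> at the undilated
      point.\<close>
    moreover have "p ^ (Suc n choose 2) / pq_fact p q (Suc n) * (1 - (q / p) ^ Suc n) =
        (1 - q / p) * 1 ^ n * (p ^ (n choose 2) / pq_fact p q n)" for n
      using exp_coeff_Suc[OF q_pos q_less, of p n] q_pos q_less by simp
    ultimately have "e (- y) - e (q / p * - y) = (1 - q / p) * - y * e (1 * - y)"
      unfolding e_def by (intro powser_dilation summable_pq_exp)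
    then show ?thesis
      by (simp add: algebra_simps)
  qed
  have inv: "e (- (z * (q / p) ^ i)) * pq_Exp p q (z * (q / p) ^ i) = e (- z) * pq_Exp p q z" for i
  proof (induction i)
    case (Suc i)
    define y where "y = z * (q / p) ^ i"
    have "y \<le> z * 1"
      unfolding y_def using ratio_bounds assms by (intro mult_left_mono power_le_one) auto
    moreover have "0 \<le> y"
      using assms ratio_bounds by (simp add: y_def)
    ultimately have "e (- (q / p * y)) = (1 + (1 - q / p) * y) * e (- y)"
      using True by (intro e) auto
    \<comment> \<open>The factor gained by \<open>e\<close> is the one that
      \<open>pq_Exp_dilate\<close> splits off from \<open>pq_Exp p q y\<close>.\<close>
    then have "e (- (q / p * y)) * pq_Exp p q (q / p * y) = e (- y) * pq_Exp p q y"
      by (subst (2) pq_Exp_dilate) simp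
    then show ?case
      using Suc.IH by (simp add: y_def mult_ac)
  qed simp
  have "(\<lambda>i. e (- z * (q / p) ^ i)) \<longlonglongrightarrow> 1"
    using tendsto_powser_dilate[where c = "\<lambda>n. p ^ (n choose 2) / pq_fact p q n"
        and R = "p / (p - q)" and r = "q / p" and x = "- z"] summable_pq_exp ratio_bounds q_pos q_less
    unfolding e_def by simp
  from tendsto_mult[OF this pq_Exp_tendsto_1[of z]]
  have "(\<lambda>i. e (- (z * (q / p) ^ i)) * pq_Exp p q (z * (q / p) ^ i)) \<longlonglongrightarrow> 1"
    by simp
  then have "e (- z) * pq_Exp p q z = 1"
    unfolding inv by (simp add: LIMSEQ_const_iff)
  moreover have "pq_exp p q (- z) = e (- z)"
    using True assms by (simp add: pq_exp_def e_def)
  ultimately show ?thesis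
    using pq_Exp_pos[OF assms] by (simp add: field_simps)
qed (simp add: pq_exp_def assms)

section \<open>Moments on the nodes\<close>

lemma pq_node_pos: "0 < pq_node p q j"
  using q_pos q_less by (simp add: pq_node_def)

lemma pq_node_plus_1: "pq_node p q (j + 1) = q / p * pq_node p q j"
  using q_pos q_less by (simp add: pq_node_def power_int_add power2_eq_square mult_ac)

lemma pq_node_int: "pq_node p q (int i) = 1 / p * (q / p) ^ i"
proof (induction i)
  case (Suc i)
  then show ?case
    using pq_node_plus_1[of "int i"] by (simp add: add.commute)
qed (simp add: pq_node_def)

text \<open>Nodes of negative index grow geometrically; the reciprocal form gives the decaying
  factor needed for comparison and for limits.\<close>

lemma inverse_pq_node_minus: "inverse (pq_node p q (- int i)) = p * (q / p) ^ i"
proof (induction i)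
  case (Suc i)
  have "inverse (pq_node p q (- int i)) * (q / p) = inverse (pq_node p q (- int (Suc i)))"
    using pq_node_plus_1[of "- int (Suc i)"] q_pos q_less by (simp add: inverse_eq_divide)
  then show ?case
    using Suc.IH by (simp add: mult_ac)
qed (simp add: pq_node_def)

text \<open>Only the highest moment is known to converge, while the induction descends. For
  \<open>j \<ge> 0\<close> boundedness of \<open>g\<close> and the decay of the nodes suffice. For
  \<open>j < 0\<close> the terms of the higher moment tend to 0, hence are bounded, and dividing by
  a node contributes a geometric factor.\<close>

lemma bisums_lower_moment:
  assumes "bisums (\<lambda>j. pq_node p q j ^ Suc (Suc n) * g j) S" and "Bseq (\<lambda>i. g (int i))"
  obtains T where "bisums (\<lambda>j. pq_node p q j ^ Suc n * g j) T"
proof -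
  have "summable (\<lambda>i. (q / p) ^ i * (pq_node p q (int i) ^ n / p * g (int i)))"
  proof (intro summable_geometric_times_Bseq Bseq_mult assms(2))
    have "(\<lambda>i. (1 / p * (q / p) ^ i) ^ n / p) \<longlonglongrightarrow> (1 / p * 0) ^ n / p"
      using ratio_bounds by (intro tendsto_intros LIMSEQ_power_zero) auto
    then show "Bseq (\<lambda>i. pq_node p q (int i) ^ n / p)"
      unfolding pq_node_int by (rule convergentI[THEN convergent_imp_Bseq])
  qed (use ratio_bounds in auto)
  then have 1: "summable (\<lambda>i. pq_node p q (int i) ^ Suc n * g (int i))"
    by (simp add: pq_node_int mult_ac)
  have "summable (\<lambda>i. pq_node p q (- int (Suc i)) ^ Suc (Suc n) * g (- int (Suc i)))"
    using assms(1) unfolding bisums_def by (auto simp: summable_def)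
  then have "Bseq (\<lambda>i. pq_node p q (- int (Suc i)) ^ Suc (Suc n) * g (- int (Suc i)))"
    by (rule summable_LIMSEQ_zero[THEN convergentI, THEN convergent_imp_Bseq])
  \<comment> \<open>The factor \<open>q * (q / p) ^ i\<close> equals
    \<open>p * (q / p) ^ Suc i\<close>, the reciprocal of the node with index
    \<open>- int (Suc i)\<close>.\<close>
  then have "summable (\<lambda>i. q * ((q / p) ^ i *
      (pq_node p q (- int (Suc i)) ^ Suc (Suc n) * g (- int (Suc i)))))"
    using ratio_bounds by (intro summable_mult summable_geometric_times_Bseq) auto
  moreover have "q * ((q / p) ^ i * (pq_node p q (- int (Suc i)) ^ Suc (Suc n) * g (- int (Suc i))))
      = pq_node p q (- int (Suc i)) ^ Suc n * g (- int (Suc i))" for i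
  proof -
    have "q * (q / p) ^ i = inverse (pq_node p q (- int (Suc i)))"
      unfolding inverse_pq_node_minus using q_pos q_less by simp
    then have "q * (q / p) ^ i * pq_node p q (- int (Suc i)) = 1"
      using pq_node_pos[of "- int (Suc i)"] by simp
    then have "(q * (q / p) ^ i * pq_node p q (- int (Suc i))) *
        (pq_node p q (- int (Suc i)) ^ Suc n * g (- int (Suc i))) =
        pq_node p q (- int (Suc i)) ^ Suc n * g (- int (Suc i))"
      by simp
    then show ?thesis
      by (simp only: power_Suc[of _ "Suc n"] mult_ac)
  qed
  ultimately have 2: "summable (\<lambda>i. pq_node p q (- int (Suc i)) ^ Suc n * g (- int (Suc i)))"
    by (simp only:)
  show thesis
    using 1 2 that unfolding bisums_def by (blast intro: summable_sums)
qed

text \<open>The node at \<open>j\<close> is \<open>p / q\<close> times the node at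
  \<open>j + 1\<close>, so after extracting \<open>(p / q) ^ m\<close> this is shift
  invariance.\<close>

lemma bisums_shifted_moment:
  assumes "bisums (\<lambda>j. pq_node p q j ^ m * g j) S"
  shows "bisums (\<lambda>j. pq_node p q j ^ m * g (j + 1)) ((p / q) ^ m * S)"
proof -
  have "bisums (\<lambda>j. (p / q) ^ m * (pq_node p q (j + 1) ^ m * g (j + 1))) ((p / q) ^ m * S)"
    by (intro bisums_cmult bisums_shift[OF assms])
  moreover have "(p / q) ^ m * (pq_node p q (j + 1) ^ m * g (j + 1)) =
      pq_node p q j ^ m * g (j + 1)" for j
    using q_pos q_less by (simp add: pq_node_plus_1 power_mult_distrib power_divide)
  ultimately show ?thesis
    by simp
qed

text \<open>Stated without division, so that the induction needs no nonvanishing factors.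
  \<open>S\<close> is arbitrary in the induction because the lower moment is a different
  sum.\<close>

lemma moment_formula:
  assumes rec: "\<And>j. (p + (p - q) * a * pq_node p q j) * g (j + 1) =
      (p + (p - q) * p * s * pq_node p q j) * g j"
    and lim: "(\<lambda>i. g (int i)) \<longlonglongrightarrow> 1"
    and S: "bisums (\<lambda>j. pq_node p q j ^ Suc n * g j) S"
  shows "(p - q) * S * (\<Prod>k=0..n. q ^ Suc k * s - a * p ^ k) = q ^ Suc n * pq_fact p q n"
  using S
proof (induction n arbitrary: S)
  case 0
  \<comment> \<open>Terms of a convergent series tend to 0; dividing by the growing nodes then gives
    \<open>g \<rightarrow> 0\<close> at minus infinity.\<close>
  have "(\<lambda>i. pq_node p q (- int (Suc i)) ^ Suc 0 * g (- int (Suc i))) \<longlonglongrightarrow> 0"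
    using 0 unfolding bisums_def by (auto dest: sums_summable summable_LIMSEQ_zero)
  then have "(\<lambda>i. pq_node p q (- int i) * g (- int i)) \<longlonglongrightarrow> 0"
    using filterlim_sequentially_Suc[of "\<lambda>i. pq_node p q (- int i) * g (- int i)"] by simp
  moreover have "(\<lambda>i. p * (q / p) ^ i) \<longlonglongrightarrow> p * 0"
    using ratio_bounds by (intro tendsto_intros LIMSEQ_power_zero) auto
  ultimately have "(\<lambda>i. p * (q / p) ^ i * (pq_node p q (- int i) * g (- int i))) \<longlonglongrightarrow> p * 0 * 0"
    by (rule tendsto_mult[rotated])
  moreover have "p * (q / p) ^ i * (pq_node p q (- int i) * g (- int i)) = g (- int i)" for i
    unfolding inverse_pq_node_minus[symmetric] using pq_node_pos[of "- int i"] by simp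
  ultimately have "(\<lambda>i. g (- int i)) \<longlonglongrightarrow> 0"
    by simp
  from bisums_cmult[OF bisums_telescope[OF lim this], of p]
  have "bisums (\<lambda>j. p * (g j - g (j + 1))) (- p)"
    by simp
  \<comment> \<open>By \<open>rec\<close> this is the same bilateral series as the telescoping one,
    whose sum is \<open>- p\<close>; equating the two sums determines \<open>S\<close>.\<close>
  moreover have "bisums (\<lambda>j. (p - q) * a * (pq_node p q j ^ Suc 0 * g (j + 1)) +
      - ((p - q) * p * s) * (pq_node p q j ^ Suc 0 * g j))
      ((p - q) * a * ((p / q) ^ Suc 0 * S) + - ((p - q) * p * s) * S)"
    by (intro bisums_add bisums_cmult bisums_shifted_moment 0)
  moreover have "(p - q) * a * (pq_node p q j ^ Suc 0 * g (j + 1)) +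
      - ((p - q) * p * s) * (pq_node p q j ^ Suc 0 * g j) = p * (g j - g (j + 1))" for j
    using rec[of j] by (simp add: algebra_simps)
  ultimately have "(p - q) * a * ((p / q) ^ Suc 0 * S) + - ((p - q) * p * s) * S = - p"
    by (simp add: bisums_unique)
  then have "p * ((p - q) * S * (q * s - a)) = p * q"
    using q_pos by (simp add: field_simps)
  then show ?case
    using q_pos q_less by simp
next
  case (Suc n)
  obtain T where T: "bisums (\<lambda>j. pq_node p q j ^ Suc n * g j) T"
    by (rule bisums_lower_moment[OF Suc.prems convergent_imp_Bseq[OF convergentI[OF lim]]])
  let ?x = "pq_node p q"
  \<comment> \<open>Both sides of \<open>rec\<close>, multiplied by the node to the power
    \<open>Suc n\<close>, are summed separately and compared, which yields one linear relation
    between \<open>S\<close> and \<open>T\<close>.\<close>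
  have "bisums (\<lambda>j. p * (?x j ^ Suc n * g (j + 1)) + (p - q) * a * (?x j ^ Suc (Suc n) * g (j + 1)))
      (p * ((p / q) ^ Suc n * T) + (p - q) * a * ((p / q) ^ Suc (Suc n) * S))"
    by (intro bisums_add bisums_cmult bisums_shifted_moment T Suc.prems)
  moreover have "bisums (\<lambda>j. p * (?x j ^ Suc n * g j) + (p - q) * p * s * (?x j ^ Suc (Suc n) * g j))
      (p * T + (p - q) * p * s * S)"
    by (intro bisums_add bisums_cmult T Suc.prems)
  moreover have "p * (?x j ^ Suc n * g (j + 1)) + (p - q) * a * (?x j ^ Suc (Suc n) * g (j + 1)) =
      p * (?x j ^ Suc n * g j) + (p - q) * p * s * (?x j ^ Suc (Suc n) * g j)" for j
  proof -
    have "?x j ^ Suc n * ((p + (p - q) * a * ?x j) * g (j + 1)) =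
        ?x j ^ Suc n * ((p + (p - q) * p * s * ?x j) * g j)"
      by (simp only: rec)
    then show ?thesis
      by (simp only: power_Suc[of _ "Suc n"]) (simp add: algebra_simps del: power_Suc)
  qed
  ultimately have "p * ((p / q) ^ Suc n * T) + (p - q) * a * ((p / q) ^ Suc (Suc n) * S) =
      p * T + (p - q) * p * s * S"
    by (simp add: bisums_unique)
  moreover define P Q where "P = p ^ Suc n" and "Q = q ^ Suc n"
  moreover have "(p / q) ^ Suc n = P / Q"
    by (simp only: P_def Q_def power_divide)
  ultimately have "p * (P / Q * T) + (p - q) * a * (p / q * (P / Q) * S) =
      p * T + (p - q) * p * s * S"
    by (simp only: power_Suc[of "p / q" "Suc n"])
  moreover have "0 < Q"
    using q_pos by (simp add: Q_def)
  ultimately have "p * (q * (P - Q) * T) = p * ((p - q) * S * (q * Q * s - a * P))"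
    using q_pos by (simp add: field_simps)
  then have "q * (P - Q) * T = (p - q) * S * (q * Q * s - a * P)"
    using q_pos q_less by simp
  \<comment> \<open>The difference \<open>P - Q\<close> is
    \<open>pq_number p q (Suc n) * (p - q)\<close>: it supplies the new factor of the factorial and
    the \<open>p - q\<close> in front of \<open>T\<close>.\<close>
  then have step: "(p - q) * S * (q ^ Suc (Suc n) * s - a * p ^ Suc n) =
      q * pq_number p q (Suc n) * ((p - q) * T)"
    unfolding P_def Q_def pq_number_mult[OF q_less, symmetric] by (auto simp: mult_ac)
  have "(p - q) * S * (\<Prod>k=0..Suc n. q ^ Suc k * s - a * p ^ k) =
      (p - q) * S * (q ^ Suc (Suc n) * s - a * p ^ Suc n) * (\<Prod>k=0..n. q ^ Suc k * s - a * p ^ k)"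
    by simp
  also have "\<dots> = q * pq_number p q (Suc n) *
      ((p - q) * T * (\<Prod>k=0..n. q ^ Suc k * s - a * p ^ k))"
    unfolding step by (simp only: mult_ac)
  also have "\<dots> = q ^ Suc (Suc n) * pq_fact p q (Suc n)"
    unfolding Suc.IH[OF T] pq_fact_Suc by simp
  finally show ?case .
qed

end

section \<open>The stated form of the denominator, and the transform\<close>

lemma denominator_prod:
  fixes p q a s :: real
  shows "(\<Prod>k=0..n. q ^ (n + 1 - k) * p ^ k * s - a * p ^ n) =
    p ^ ((n + 1) choose 2) * (\<Prod>k=0..n. q ^ Suc k * s - a * p ^ k)"
proof -
  \<comment> \<open>Pull \<open>p ^ k\<close> out of the factor with index \<open>k\<close>. The
    extracted exponents add up to \<open>(n + 1) choose 2\<close>, and reversing the index gives the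
    product from \<open>moment_formula\<close>.\<close>
  have "(\<Prod>k=0..n. q ^ (n + 1 - k) * p ^ k * s - a * p ^ n) =
      (\<Prod>k=0..n. p ^ k * (q ^ Suc (n - k) * s - a * p ^ (n - k)))"
  proof (rule prod.cong)
    fix k assume "k \<in> {0..n}"
    then have "n + 1 - k = Suc (n - k)" "p ^ n = p ^ k * p ^ (n - k)"
      by (auto simp flip: power_add)
    then show "q ^ (n + 1 - k) * p ^ k * s - a * p ^ n =
        p ^ k * (q ^ Suc (n - k) * s - a * p ^ (n - k))"
      by (simp only:) (simp add: algebra_simps)
  qed simp
  also have "\<dots> = (\<Prod>k=0..n. p ^ k) * (\<Prod>k=0..n. q ^ Suc (n - k) * s - a * p ^ (n - k))"
    by (rule prod.distrib)
  also have "(\<Prod>k=0..n. p ^ k) = p ^ ((n + 1) choose 2)"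
    by (induction n) (simp_all add: Suc_choose_2 power_add)
  also have "(\<Prod>k=0..n. q ^ Suc (n - k) * s - a * p ^ (n - k)) =
      (\<Prod>k=0..n. q ^ Suc k * s - a * p ^ k)"
    using prod.nat_diff_reindex[of "\<lambda>k. q ^ Suc k * s - a * p ^ k" "Suc n"]
    by (simp add: atLeast0AtMost lessThan_Suc_atMost)
  finally show ?thesis .
qed

theorem corollary3p17:
  fixes p q a s :: real and n :: nat
  assumes "0 < q" and "q < p" and "0 < s"
    and "pq_laplace2_converges p q (\<lambda>t. t ^ n * pq_Exp p q (a * t)) s"
  shows "pq_laplace2 p q (\<lambda>t. t ^ n * pq_Exp p q (a * t)) s =
    q ^ (n + 1) * p ^ ((n + 1) choose 2) * pq_fact p q n /
    (\<Prod>k=0..n. (q ^ (n + 1 - k) * p ^ k * s - a * p ^ n))"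
proof -
  note pq = assms(1,2)
  let ?x = "pq_node p q"
  define g where "g = (\<lambda>j. pq_Exp p q (a * ?x j) * pq_exp p q (- p * ?x j * s))"
  \<comment> \<open>The argument of \<open>pq_exp\<close> is negative at every node, so
    \<open>pq_exp_minus\<close> covers both branches of its definition at once.\<close>
  have g: "g j = pq_Exp p q (a * ?x j) / pq_Exp p q (p * s * ?x j)" for j
    using pq_exp_minus[OF pq, of "p * s * ?x j"] pq_node_pos[OF pq, of j] assms(1-3)
    by (simp add: g_def mult_ac)
  define S where "S = (\<Sum>i. ?x (int i) ^ Suc n * g (int i)) +
    (\<Sum>i. ?x (- int (Suc i)) ^ Suc n * g (- int (Suc i)))"
  have lap: "pq_laplace2 p q (\<lambda>t. t ^ n * pq_Exp p q (a * t)) s = (p - q) * S"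
    by (simp add: pq_laplace2_def pq_integral_def S_def g_def mult_ac)
  \<comment> \<open>The node weight in the integral raises \<open>t ^ n\<close> to the power
    \<open>Suc n\<close>.\<close>
  have S: "bisums (\<lambda>j. ?x j ^ Suc n * g j) S"
    using assms(4) unfolding bisums_def S_def pq_laplace2_converges_def pq_integrable_def
    by (intro exI conjI refl summable_sums) (auto simp: g_def mult_ac)
  have rec: "(p + (p - q) * a * ?x j) * g (j + 1) = (p + (p - q) * p * s * ?x j) * g j" for j
  proof -
    \<comment> \<open>One dilation identity serves twice: \<open>c = a\<close> for the numerator of
      \<open>g\<close>, \<open>c = p * s\<close> for its denominator.\<close>
    have 1: "p * pq_Exp p q (c * ?x j) = (p + (p - q) * c * ?x j) * pq_Exp p q (c * ?x (j + 1))" for c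
      unfolding pq_node_plus_1[OF pq] using pq_Exp_dilate[OF pq, of "c * ?x j"] pq
      by (simp add: field_simps)
    have pos: "0 < pq_Exp p q (p * s * ?x i)" for i
      using pq_node_pos[OF pq, of i] assms(1-3) by (intro pq_Exp_pos) auto
    have "(p + (p - q) * a * ?x j) * pq_Exp p q (a * ?x (j + 1)) * pq_Exp p q (p * s * ?x j) =
        p * pq_Exp p q (a * ?x j) * pq_Exp p q (p * s * ?x j)"
      by (simp only: 1[of a])
    also have "\<dots> = p * pq_Exp p q (p * s * ?x j) * pq_Exp p q (a * ?x j)"
      by simp
    also have "\<dots> = (p + (p - q) * (p * s) * ?x j) * pq_Exp p q (p * s * ?x (j + 1)) *
        pq_Exp p q (a * ?x j)"
      by (simp only: 1[of "p * s"])
    finally show ?thesis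
      using pos[THEN less_imp_neq, THEN not_sym] unfolding g by (simp add: frac_eq_eq mult_ac)
  qed
  have "(\<lambda>i. g (int i)) \<longlonglongrightarrow> 1 / 1"
  proof -
    have "(\<lambda>i. pq_Exp p q (c * ?x (int i))) \<longlonglongrightarrow> 1" for c
      using pq_Exp_tendsto_1[OF pq, of "c / p"] by (simp add: pq_node_int[OF pq])
    then show ?thesis
      unfolding g by (intro tendsto_divide) auto
  qed
  then have key: "(p - q) * S * (\<Prod>k=0..n. q ^ Suc k * s - a * p ^ k) = q ^ Suc n * pq_fact p q n"
    using moment_formula[OF pq rec _ S] by simp
  \<comment> \<open>A zero factor in the product would annihilate the left side of
    \<open>key\<close>; this justifies the division that follows.\<close>
  have "q ^ Suc n * pq_fact p q n \<noteq> 0"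
    using pq pq_fact_pos[OF pq, of n] by simp
  then have "(\<Prod>k=0..n. q ^ Suc k * s - a * p ^ k) \<noteq> 0"
    using key by (metis mult_zero_right)
  then have "(p - q) * S = q ^ Suc n * pq_fact p q n / (\<Prod>k=0..n. q ^ Suc k * s - a * p ^ k)"
    using key by (simp add: field_simps)
  then show ?thesis
    using pq unfolding lap denominator_prod by simp
qed

end
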